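(* Let $d\ge 2$ and let $P$ be the $d$-cube, with $n=2^d$ vertices and $m=2d$ facets. Let $I^z=\{(i,j):\text{vertex } i \text{ lies on facet } j\}$ and set $\lambda_{ij}=d2^{1-d}$ for all $(i,j)\notin I^z$. Then the semidefinite program $$\min_X\ \mathrm{tr}(X)-\sum_{(i,j)\notin I^z}\lambda_{ij}S_{ij}\quad\text{s.t.}\quad X=\begin{bmatrix}1 & \mathbb{1}_n^\top & \mathbb{1}_m^\top\\ \mathbb{1}_n & A & S\\ \mathbb{1}_m & S^\top & B\end{bmatrix}\succeq 0,\ \ S_{ij}=0 \text{ for }(i,j)\in I^z,\ \ A_{ii}=2\ (i=1,\ldots,n)$$ has an optimal solution $X$ of rank $d+1$ whose block $S$ satisfies $S_{ij}>0$ for all $(i,j)\notin I^z$; such a solution certifies the inscribability of the $d$-cube.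
   Context: A polytope is inscribable if some combinatorially equivalent polytope has all its vertices on a sphere. In the program, $A$ ($n\times n$) and $B$ ($m\times m$) are symmetric and $S$ is $n\times m$, all real; $\mathbb{1}_k$ is the all-ones vector. By the paper's characterization, a $d$-polytope is inscribable iff there is such a positive semidefinite $X$ of rank $d+1$ with constant diagonal in $A$, $S\ge 0$, and $S$ having exactly the zero pattern $I^z$. *)

theory Defs
  imports "HOL-Analysis.Analysis"
begin

definition cube :: "(real^'d) set" where
  "cube = cbox (- 1) 1"

definition combinatorially_equivalent ::
    "'a::euclidean_space set \<Rightarrow> 'b::euclidean_space set \<Rightarrow> bool" where
  "combinatorially_equivalent P Q \<longleftrightarrow>
     (\<exists>\<phi>. bij_betw \<phi> {F. F face_of P} {G. G face_of Q} \<and>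
          (\<forall>F G. F face_of P \<longrightarrow> G face_of P \<longrightarrow> (F \<subseteq> G \<longleftrightarrow> \<phi> F \<subseteq> \<phi> G)))"

(* Keeping Q in the ambient space of P loses nothing: an inscribed polytope of the same dimension
   in a larger space is inscribed within its affine hull, which meets the sphere in a sphere. *)
definition inscribable :: "'a::euclidean_space set \<Rightarrow> bool" where
  "inscribable P \<longleftrightarrow>
     (\<exists>Q::'a set. polytope Q \<and> combinatorially_equivalent P Q \<and>
        (\<exists>c r. r > 0 \<and> {x. x extreme_point_of Q} \<subseteq> sphere c r))"

definition pos_semidefinite :: "real^'k^'k \<Rightarrow> bool" where
  "pos_semidefinite X \<longleftrightarrow> transpose X = X \<and> (\<forall>u. 0 \<le> u \<bullet> (X *v u))"

definition block_matrix ::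
    "real^'n^'n \<Rightarrow> real^'m^'n \<Rightarrow> real^'m^'m \<Rightarrow> real^(unit + 'n + 'm)^(unit + 'n + 'm)" where
  "block_matrix A S B = (\<chi> p q.
     (case p of
        Inl _ \<Rightarrow> 1
      | Inr (Inl i) \<Rightarrow>
          (case q of Inl _ \<Rightarrow> 1 | Inr (Inl k) \<Rightarrow> A $ i $ k | Inr (Inr j) \<Rightarrow> S $ i $ j)
      | Inr (Inr j) \<Rightarrow>
          (case q of Inl _ \<Rightarrow> 1 | Inr (Inl i) \<Rightarrow> S $ i $ j | Inr (Inr l) \<Rightarrow> B $ j $ l)))"

definition sdp_feasible ::
    "('n \<times> 'm) set \<Rightarrow> real^'n^'n \<Rightarrow> real^'m^'n \<Rightarrow> real^'m^'m \<Rightarrow> bool" where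
  "sdp_feasible Iz A S B \<longleftrightarrow>
     pos_semidefinite (block_matrix A S B) \<and>
     (\<forall>(i, j) \<in> Iz. S $ i $ j = 0) \<and>
     (\<forall>i. A $ i $ i = 2)"

definition sdp_objective ::
    "('n \<times> 'm) set \<Rightarrow> ('n \<Rightarrow> 'm \<Rightarrow> real) \<Rightarrow> real^'n^'n \<Rightarrow> real^'m^'n \<Rightarrow> real^'m^'m \<Rightarrow> real" where
  "sdp_objective Iz lam A S B =
     trace (block_matrix A S B) - (\<Sum>(i, j) \<in> - Iz. lam i j * S $ i $ j)"

definition sdp_optimal ::
    "('n \<times> 'm) set \<Rightarrow> ('n \<Rightarrow> 'm \<Rightarrow> real) \<Rightarrow> real^'n^'n \<Rightarrow> real^'m^'n \<Rightarrow> real^'m^'m \<Rightarrow> bool" where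
  "sdp_optimal Iz lam A S B \<longleftrightarrow>
     sdp_feasible Iz A S B \<and>
     (\<forall>A' S' B'. sdp_feasible Iz A' S' B' \<longrightarrow>
        sdp_objective Iz lam A S B \<le> sdp_objective Iz lam A' S' B')"

(* A d-polytope with vertex-facet incidences Iz is inscribable iff such A, S, B exist. *)
definition inscribability_certificate ::
    "nat \<Rightarrow> ('n \<times> 'm) set \<Rightarrow> real^'n^'n \<Rightarrow> real^'m^'n \<Rightarrow> real^'m^'m \<Rightarrow> bool" where
  "inscribability_certificate d Iz A S B \<longleftrightarrow>
     pos_semidefinite (block_matrix A S B) \<and>
     rank (block_matrix A S B) = d + 1 \<and>
     (\<exists>c. \<forall>i. A $ i $ i = c) \<and>
     (\<forall>i j. 0 \<le> S $ i $ j) \<and>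
     {(i, j). S $ i $ j = 0} = Iz"

end

theory Submission
  imports Defs
begin

text \<open>
  Regard a feasible \<open>X\<close> as the Gram matrix of vectors \<open>x\<close>, \<open>a i\<close> (vertices) and \<open>b j\<close> (facets)
  for the semidefinite form \<open>X\<close>. Let \<open>d\<close> be the dimension, \<open>N = 2 ^ d\<close> and \<open>L = 2 d / N\<close> the common
  weight. Since \<open>S\<close> vanishes on the incidences, the facet with outer normal \<open>s e\<^sub>k\<close> contributes
  \<open>\<langle>b, b\<rangle> + L s \<langle>C k, b\<rangle>\<close> to the objective, where \<open>C k\<close> is the sum of the \<open>a i\<close> with the
  \<open>k\<close>-th vertex coordinates as signs. As \<open>C k\<close> is orthogonal to \<open>x\<close>, completing the square bounds this
  below by \<open>1 - (L / 2)\<^sup>2 \<langle>C k, C k\<rangle>\<close>. The coordinate functions are orthogonal on the vertices and the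
  vectors \<open>a i - x\<close> have norm one, so Bessel's inequality gives \<open>\<Sum>\<^sub>k \<langle>C k, C k\<rangle> \<le> N\<^sup>2\<close>. The Gram
  matrix of the regular cube and its polar dual attains the resulting bound and has rank \<open>d + 1\<close>.
\<close>

lemma sum_UNIV_sum_type:
  fixes f :: "'a::finite + 'b::finite \<Rightarrow> 'c::comm_monoid_add"
  shows "(\<Sum>p\<in>UNIV. f p) = (\<Sum>a\<in>UNIV. f (Inl a)) + (\<Sum>b\<in>UNIV. f (Inr b))"
  by (simp add: sum.Plus comp_def flip: UNIV_Plus_UNIV)

subsection \<open>Vertices and facets of the cube\<close>

lemma mem_cube: "x \<in> cube \<longleftrightarrow> (\<forall>k. \<bar>x $ k\<bar> \<le> 1)"
  by (auto simp: cube_def mem_box_cart abs_le_iff minus_le_iff)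

text \<open>The endpoints of [-1, 1] are extreme: for the combination \<open>c\<close> with
  \<open>c * c = 1\<close>, both \<open>c * c - c * a\<close> and \<open>c * c - c * b\<close> are
  nonnegative with weighted sum zero, so both vanish.\<close>

lemma convex_combination_unit_interval:
  fixes a b u :: real
  assumes "0 < u" "u < 1" "\<bar>a\<bar> \<le> 1" "\<bar>b\<bar> \<le> 1" "(1 - u) * a + u * b \<in> {-1, 1}"
  shows "a = b"
proof -
  define c where "c = (1 - u) * a + u * b"
  have c: "c = 1 \<or> c = -1" using assms(5) by (auto simp: c_def)
  have 0: "(1 - u) * (c * c - c * a) + u * (c * c - c * b) = 0"
    by (simp add: c_def algebra_simps)
  have 1: "c * c - c * a \<ge> 0" "c * c - c * b \<ge> 0"
    using c assms(3,4) by auto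
  have "(1 - u) * (c * c - c * a) \<ge> 0" "u * (c * c - c * b) \<ge> 0"
    using 1 assms(1,2) by auto
  then have "c * c - c * a = 0" "c * c - c * b = 0"
    using 0 assms(1,2) by (auto simp: add_nonneg_eq_0_iff)
  then show ?thesis using c by auto
qed

lemma extreme_point_of_cube:
  fixes x :: "real^'d"
  shows "x extreme_point_of cube \<longleftrightarrow> (\<forall>k. x $ k \<in> {-1, 1})"
proof
  assume x: "x extreme_point_of cube"
  then have xc: "\<And>k. \<bar>x $ k\<bar> \<le> 1"
    by (simp add: extreme_point_of_def mem_cube)
  show "\<forall>k. x $ k \<in> {-1, 1}"
  proof (rule ccontr)
    assume "\<not> (\<forall>k. x $ k \<in> {-1, 1})"
    then obtain k where "x $ k \<noteq> -1" "x $ k \<noteq> 1" by auto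
    with xc[of k] have k: "\<bar>x $ k\<bar> < 1" by linarith
    \<comment> \<open>A coordinate strictly inside (-1, 1) can move both ways by its distance to the
      nearer endpoint, which makes \<open>x\<close> the midpoint of a segment in the cube.\<close>
    define e where "e = (1 - \<bar>x $ k\<bar>) *\<^sub>R (axis k 1 :: real^'d)"
    have comp: "e $ l = (if l = k then 1 - \<bar>x $ k\<bar> else 0)" for l
      by (simp add: e_def axis_def)
    have "x - e \<in> cube" "x + e \<in> cube"
      using xc k by (auto simp: mem_cube comp)
    moreover have "x \<in> open_segment (x - e) (x + e)"
    proof -
      have "midpoint (x - e) (x + e) = x"
        by (simp add: midpoint_def flip: scaleR_2)
      moreover have "x - e \<noteq> x + e"
      proof
        assume eq: "x - e = x + e"
        have "(x - e) $ k = (x + e) $ k" by (simp only: eq)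
        then show False using k by (simp add: comp)
      qed
      ultimately show ?thesis
        using midpoint_in_open_segment[of "x - e" "x + e"] by simp
    qed
    ultimately show False
      using x by (auto simp: extreme_point_of_def)
  qed
next
  assume x: "\<forall>k. x $ k \<in> {-1, 1}"
  then have "\<bar>x $ k\<bar> \<le> 1" for k
    by (metis abs_minus_cancel abs_one empty_iff insert_iff order_refl)
  then have "x \<in> cube" by (simp add: mem_cube)
  moreover have "x \<notin> open_segment a b" if a: "a \<in> cube" and b: "b \<in> cube" for a b
  proof
    assume "x \<in> open_segment a b"
    then obtain u where u: "a \<noteq> b" "0 < u" "u < 1" "x = (1 - u) *\<^sub>R a + u *\<^sub>R b"
      by (auto simp: in_segment)
    have "a $ k = b $ k" for k
      by (rule convex_combination_unit_interval[of u])
         (use u x a b in \<open>auto simp: mem_cube\<close>)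
    with u show False by (simp add: vec_eq_iff)
  qed
  ultimately show "x extreme_point_of cube" by (simp add: extreme_point_of_def)
qed

text \<open>The product form lets \<open>card_PiE\<close> count the vertices.\<close>

lemma extreme_points_of_cube:
  "{x. x extreme_point_of (cube :: (real^'d) set)} =
     vec_lambda ` (UNIV \<rightarrow>\<^sub>E {-1, 1})"
proof
  show "{x. x extreme_point_of (cube :: (real^'d) set)} \<subseteq> vec_lambda ` (UNIV \<rightarrow>\<^sub>E {-1, 1})"
  proof
    fix x :: "real^'d"
    assume "x \<in> {x. x extreme_point_of cube}"
    then have "vec_nth x \<in> UNIV \<rightarrow>\<^sub>E {-1, 1}"
      by (simp add: extreme_point_of_cube PiE_def Pi_def)
    then show "x \<in> vec_lambda ` (UNIV \<rightarrow>\<^sub>E {-1, 1})"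
      by (metis image_eqI vec_nth_inverse)
  qed
qed (auto simp: extreme_point_of_cube PiE_def Pi_def)

lemma card_extreme_points_of_cube:
  "card {x. x extreme_point_of (cube :: (real^'d) set)} = 2 ^ CARD('d)"
proof -
  have "inj_on vec_lambda (UNIV \<rightarrow>\<^sub>E {-1, 1 :: real} :: ('d \<Rightarrow> real) set)"
    by (rule inj_onI) (metis vec_lambda_inverse UNIV_I)
  then show ?thesis
    by (simp add: extreme_points_of_cube card_image card_PiE numeral_2_eq_2)
qed

section \<open>Coordinate sums over the vertices\<close>

text \<open>Reflecting coordinate \<open>k\<close> is an involution on the vertices, so the sum of a
  function that it negates equals its own negative.\<close>

lemma sum_extreme_points_of_cube_odd:
  fixes k :: "'d::finite"
  assumes "\<And>x. f (x :: real^'d) = - f (\<chi> l. if l = k then - x $ l else x $ l)"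
  shows "(\<Sum>x | x extreme_point_of cube. f x) = (0 :: real)"
proof -
  let ?r = "\<lambda>x :: real^'d. \<chi> l. if l = k then - x $ l else x $ l"
  have "(\<Sum>x | x extreme_point_of cube. f x) = (\<Sum>x | x extreme_point_of cube. - f x)"
  proof (rule sum.reindex_bij_witness[of _ ?r ?r])
    show "- f (?r x) = f x" for x by (rule assms[symmetric])
  qed (auto simp: extreme_point_of_cube vec_eq_iff)
  then show ?thesis by (simp add: sum_negf)
qed

lemma sum_cube_coordinate:
  "(\<Sum>x | x extreme_point_of (cube :: (real^'d) set). x $ k) = 0"
  by (rule sum_extreme_points_of_cube_odd[of _ k]) simp

lemma sum_cube_coordinate_mult:
  "(\<Sum>x | x extreme_point_of (cube :: (real^'d) set). x $ k * x $ l) =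
     (if k = l then 2 ^ CARD('d) else 0)"
proof (cases "k = l")
  case True
  have "x $ k * x $ k = 1" if "x extreme_point_of cube" for x :: "real^'d"
    using spec[OF that[unfolded extreme_point_of_cube], of k] by auto
  then show ?thesis using True by (simp add: card_extreme_points_of_cube)
next
  case False
  then show ?thesis
    by (simp add: sum_extreme_points_of_cube_odd[of _ k])
qed

section \<open>Facets of the cube\<close>

text \<open>\<open>facet_of_polyhedron_explicit\<close> reads the facets off an irredundant system
  of halfspaces. The system \<open>s * x $ k \<le> 1\<close> is irredundant because each member is
  violated by a point that satisfies all the others.\<close>

lemma facet_of_cube:
  "G facet_of (cube :: (real^'d) set) \<longleftrightarrow>
     (\<exists>k. \<exists>s\<in>{-1, 1}. G = {x \<in> cube. x $ k = s})"
proof -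
  define I where "I = (UNIV :: 'd set) \<times> {-1, 1 :: real}"
  define H where "H = (\<lambda>(k, s). {x :: real^'d. s * x $ k \<le> 1})"
  \<comment> \<open>Normals have to be indexed by halfspaces, so the label is recovered by inverting
    \<open>H\<close>.\<close>
  define a where "a = (\<lambda>h. (\<lambda>(k, s). s *\<^sub>R (axis k 1 :: real^'d)) (the_inv_into I H h))"
  \<comment> \<open>This point lies beyond facet \<open>(k, s)\<close> and inside every other
    halfspace. It yields both the injectivity of \<open>H\<close> and irredundancy.\<close>
  define z where "z = (\<lambda>(k, s). (2 * s) *\<^sub>R (axis k 1 :: real^'d))"
  have z: "z q \<in> H p \<longleftrightarrow> p \<noteq> q" if "p \<in> I" "q \<in> I" for p q
    using that by (auto simp: I_def H_def z_def axis_def split: if_splits)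
  have inj: "inj_on H I"
    by (rule inj_onI) (metis z)
  have a: "a (H (k, s)) = s *\<^sub>R axis k 1" if "(k, s) \<in> I" for k s
    using the_inv_into_f_f[OF inj that] by (simp add: a_def)
  have cube: "cube = \<Inter> (H ` I)"
    by (auto simp: mem_cube I_def H_def abs_le_iff)
  have "(0 :: real^'d) \<in> interior cube" by (simp add: cube_def interior_cbox mem_box_cart)
  then have hull: "affine hull (cube :: (real^'d) set) = UNIV"
    by (intro affine_hull_nonempty_interior) blast
  have "G facet_of (cube :: (real^'d) set) \<longleftrightarrow> (\<exists>h. h \<in> H ` I \<and> G = cube \<inter> {x. a h \<bullet> x = 1})"
  proof (rule facet_of_polyhedron_explicit)
    show "finite (H ` I)" by (simp add: I_def)
    show "cube = affine hull cube \<inter> \<Inter> (H ` I)" by (simp only: hull Int_UNIV_left) (rule cube)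
    show "a h \<noteq> 0 \<and> h = {x. a h \<bullet> x \<le> 1}" if h: "h \<in> H ` I" for h
    proof -
      obtain p where p: "p \<in> I" "h = H p" using h by blast
      obtain k s where "p = (k, s)" by (cases p)
      with p have ks: "(k, s) \<in> I" "h = H (k, s)" by simp_all
      then show ?thesis
        unfolding ks(2) a[OF ks(1)]
        by (auto simp: I_def H_def axis_eq_0_iff inner_axis')
    qed
    show "cube \<subset> affine hull cube \<inter> \<Inter> F'" if F': "F' \<subset> H ` I" for F'
    proof -
      obtain q where q: "q \<in> I" "H q \<notin> F'" using F' by auto
      have "z q \<in> h" if h: "h \<in> F'" for h
      proof -
        obtain p where "p \<in> I" "h = H p" using F' h by blast
        then show ?thesis using z q h by metis
      qed
      moreover have "z q \<notin> cube" using z[OF q(1) q(1)] q(1) by (auto simp: cube)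
      ultimately show ?thesis unfolding hull using F' by (auto simp: cube)
    qed
  qed
  also have "\<dots> \<longleftrightarrow> (\<exists>(k, s)\<in>I. G = cube \<inter> {x. a (H (k, s)) \<bullet> x = 1})" by auto
  also have "\<dots> \<longleftrightarrow> (\<exists>(k, s)\<in>I. G = {x \<in> cube. x $ k = s})"
  proof -
    have "cube \<inter> {x. a (H (k, s)) \<bullet> x = 1} = {x \<in> cube. x $ k = s}" if "(k, s) \<in> I" for k s
      unfolding a[OF that] using that by (auto simp: I_def inner_axis')
    then show ?thesis by (intro bex_cong refl) (auto split: prod.splits)
  qed
  also have "\<dots> \<longleftrightarrow> (\<exists>k. \<exists>s\<in>{-1, 1}. G = {x \<in> cube. x $ k = s})"
    by (auto simp: I_def)
  finally show ?thesis .
qed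

lemma bij_betw_facets_of_cube:
  "bij_betw (\<lambda>(k, s). {x \<in> cube. x $ k = s}) (UNIV \<times> {-1, 1}) {G. G facet_of (cube :: (real^'d) set)}"
proof (rule bij_betwI')
  fix p q assume "p \<in> (UNIV :: 'd set) \<times> {-1, 1 :: real}" "q \<in> (UNIV :: 'd set) \<times> {-1, 1 :: real}"
  then obtain k s k' s' where p: "p = (k, s)" "s \<in> {-1, 1}" and q: "q = (k', s')" "s' \<in> {-1, 1}"
    by (cases p, cases q) blast
  have inj: "k = k' \<and> s = s'"
    if "s \<in> {-1, 1}" "s' \<in> {-1, 1}" "{x \<in> cube. x $ k = s} = {x \<in> cube. x $ k' = s'}"
    for k k' :: 'd and s s' :: real
  proof -
    \<comment> \<open>The centre of one facet has a single nonzero coordinate, so its membership in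
      the other facet forces equal labels.\<close>
    have "s *\<^sub>R axis k 1 \<in> {x \<in> cube. x $ k = s}"
      using that(1) by (auto simp: mem_cube axis_def)
    then have "(s *\<^sub>R axis k 1 :: real^'d) $ k' = s'"
      unfolding that(3) by simp
    with that(1,2) show ?thesis by (auto simp: axis_def split: if_splits)
  qed
  show "((\<lambda>(k, s). {x \<in> cube. x $ k = s}) p = (\<lambda>(k, s). {x \<in> cube. x $ k = s}) q) = (p = q)"
    unfolding p(1) q(1) prod.case prod.inject using inj[OF p(2) q(2), of k k'] by blast
qed (auto simp: facet_of_cube)

text \<open>The cube is its own witness: all coordinates of its vertices have absolute value one, so
  all vertices have the same norm.\<close>

lemma inscribable_cube: "inscribable (cube :: (real^'d) set)"
  unfolding inscribable_def
proof (intro exI conjI)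
  show "polytope (cube :: (real^'d) set)" by (simp add: cube_def polytope_interval)
  show "combinatorially_equivalent (cube :: (real^'d) set) (cube :: (real^'d) set)"
    unfolding combinatorially_equivalent_def by (rule exI[of _ id]) auto
  have "norm x = sqrt CARD('d)" if "x extreme_point_of cube" for x :: "real^'d"
  proof -
    have "(norm (x $ k))\<^sup>2 = 1" for k
      using that by (auto simp: extreme_point_of_cube power2_eq_1_iff)
    then show ?thesis by (simp add: norm_vec_def L2_set_def)
  qed
  then show "{x :: real^'d. x extreme_point_of cube} \<subseteq> sphere 0 (sqrt CARD('d))"
    by auto
qed simp

subsection \<open>Positive semidefinite forms\<close>

text \<open>The columns of \<sigma> are orthogonal with squared norm \<open>N\<close>. Projecting
  the family \<open>p\<close> onto their span leaves a residual on which the form is nonnegative;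
  expanding it gives the bound.\<close>

lemma Bessel_inequality_form:
  fixes \<beta> :: "'v::real_vector \<Rightarrow> 'v \<Rightarrow> real"
    and p :: "'n::finite \<Rightarrow> 'v"
    and \<sigma> :: "'n::finite \<Rightarrow> 'd::finite \<Rightarrow> real"
  assumes bil: "bilinear \<beta>" and sym: "\<And>x y. \<beta> x y = \<beta> y x" and psd: "\<And>x. 0 \<le> \<beta> x x"
    and N: "N > 0" and orth: "\<And>k l. (\<Sum>i\<in>UNIV. \<sigma> i k * \<sigma> i l) = (if k = l then N else 0)"
  defines "C \<equiv> \<lambda>k. \<Sum>i\<in>UNIV. \<sigma> i k *\<^sub>R p i"
  shows "(\<Sum>k\<in>UNIV. \<beta> (C k) (C k)) \<le> N * (\<Sum>i\<in>UNIV. \<beta> (p i) (p i))"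
proof -
  have lin: "linear (\<beta> x)" "linear (\<lambda>x. \<beta> x y)" for x y
    using bil by (auto simp: bilinear_def)
  \<comment> \<open>\<open>q i\<close> is \<open>N\<close> times the \<open>i\<close>-th member of
    the projected family; the factor avoids division.\<close>
  define q where "q = (\<lambda>i. \<Sum>k\<in>UNIV. \<sigma> i k *\<^sub>R C k)"
  have pq: "(\<Sum>i\<in>UNIV. \<beta> (p i) (q i)) = (\<Sum>k\<in>UNIV. \<beta> (C k) (C k))"
  proof -
    have "(\<Sum>i\<in>UNIV. \<beta> (p i) (q i)) = (\<Sum>i\<in>UNIV. \<Sum>k\<in>UNIV. \<sigma> i k * \<beta> (p i) (C k))"
      by (simp add: q_def linear_sum[OF lin(1)] bilinear_rmul[OF bil])
    also have "\<dots> = (\<Sum>k\<in>UNIV. \<Sum>i\<in>UNIV. \<sigma> i k * \<beta> (p i) (C k))"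
      by (rule sum.swap)
    also have "\<dots> = (\<Sum>k\<in>UNIV. \<beta> (C k) (C k))"
    proof (rule sum.cong[OF refl])
      fix k
      have "\<beta> (C k) y = (\<Sum>i\<in>UNIV. \<sigma> i k * \<beta> (p i) y)" for y
        by (simp add: C_def linear_sum[OF lin(2)] bilinear_lmul[OF bil])
      then show "(\<Sum>i\<in>UNIV. \<sigma> i k * \<beta> (p i) (C k)) = \<beta> (C k) (C k)" by simp
    qed
    finally show ?thesis .
  qed
  have qr: "\<beta> y (q i) = (\<Sum>k\<in>UNIV. \<sigma> i k * \<beta> y (C k))"
    and ql: "\<beta> (q i) y = (\<Sum>k\<in>UNIV. \<sigma> i k * \<beta> (C k) y)" for i y
    by (simp_all add: q_def linear_sum[OF lin(1)] linear_sum[OF lin(2)] bilinear_rmul[OF bil]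
        bilinear_lmul[OF bil])
  have qq: "(\<Sum>i\<in>UNIV. \<beta> (q i) (q i)) = N * (\<Sum>k\<in>UNIV. \<beta> (C k) (C k))"
  proof -
    have "(\<Sum>i\<in>UNIV. \<beta> (q i) (q i)) =
        (\<Sum>i\<in>UNIV. \<Sum>k\<in>UNIV. \<Sum>l\<in>UNIV. \<sigma> i k * \<sigma> i l * \<beta> (C k) (C l))"
      by (simp only: ql) (simp only: qr sum_distrib_left mult.assoc)
    also have "\<dots> = (\<Sum>k\<in>UNIV. \<Sum>l\<in>UNIV. \<Sum>i\<in>UNIV. \<sigma> i k * \<sigma> i l * \<beta> (C k) (C l))"
      by (subst sum.swap) (intro sum.cong refl sum.swap)
    also have "\<dots> = (\<Sum>k\<in>UNIV. \<Sum>l\<in>UNIV. if k = l then N * \<beta> (C k) (C l) else 0)"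
      by (intro sum.cong refl) (simp add: orth flip: sum_distrib_right)
    also have "\<dots> = N * (\<Sum>k\<in>UNIV. \<beta> (C k) (C k))"
      by (simp add: sum_distrib_left)
    finally show ?thesis .
  qed
  \<comment> \<open>By \<open>pq\<close> and \<open>qq\<close>, the mixed and quadratic terms of the
    scaled residual add up to \<open>- N\<close> times the left-hand sum of the claim.\<close>
  have "0 \<le> (\<Sum>i\<in>UNIV. \<beta> (N *\<^sub>R p i - q i) (N *\<^sub>R p i - q i))"
    by (intro sum_nonneg psd)
  also have "\<dots> = (\<Sum>i\<in>UNIV. N * N * \<beta> (p i) (p i) - 2 * N * \<beta> (p i) (q i) + \<beta> (q i) (q i))"
    by (intro sum.cong refl)
       (simp add: bilinear_lsub[OF bil] bilinear_rsub[OF bil] bilinear_lmul[OF bil]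
         bilinear_rmul[OF bil] sym[of "q i" "p i" for i] algebra_simps)
  also have "\<dots> = N * (N * (\<Sum>i\<in>UNIV. \<beta> (p i) (p i)) - (\<Sum>k\<in>UNIV. \<beta> (C k) (C k)))"
    by (simp add: sum.distrib sum_subtractf pq qq algebra_simps flip: sum_distrib_left)
  finally show ?thesis using N by (simp add: zero_le_mult_iff)
qed

text \<open>Expand the form at \<open>b + c - x\<close>. Subtracting \<open>x\<close> removes the
  component of \<open>b\<close> along \<open>x\<close>, which improves the bare bound
  \<open>- \<beta> c c\<close> by one.\<close>

lemma completed_square_form:
  fixes \<beta> :: "'v::real_vector \<Rightarrow> 'v \<Rightarrow> real"
  assumes bil: "bilinear \<beta>" and sym: "\<And>x y. \<beta> x y = \<beta> y x" and psd: "\<And>x. 0 \<le> \<beta> x x"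
    and "\<beta> x x = 1" "\<beta> x b = 1" "\<beta> x c = 0"
  shows "1 - \<beta> c c \<le> \<beta> b b + 2 * \<beta> c b"
proof -
  have "0 \<le> \<beta> (b + c - x) (b + c - x)" by (rule psd)
  also have "\<dots> = \<beta> b b + 2 * \<beta> c b + \<beta> c c - 1"
    using assms(4-6)
    by (simp add: bilinear_lsub[OF bil] bilinear_rsub[OF bil] bilinear_ladd[OF bil]
        bilinear_radd[OF bil] sym[of b c] sym[of b x] sym[of c x])
  finally show ?thesis by simp
qed

text \<open>Row rank equals column rank, so \<open>transpose Y\<close> is surjective and the product
  has the same range as \<open>Y\<close>.\<close>

lemma rank_mul_transpose_inj:
  fixes Y :: "real^'k^'p"
  assumes "inj ((*v) Y)"
  shows "rank (Y ** transpose Y) = CARD('k)"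
proof -
  have r: "rank Y = CARD('k)" using assms by (simp add: full_rank_injective)
  then have "surj ((*v) (transpose Y))"
    by (metis rank_transpose full_rank_surjective)
  moreover have "range ((*v) (Y ** transpose Y)) = (*v) Y ` range ((*v) (transpose Y))"
    by (simp only: image_image matrix_vector_mul_assoc)
  ultimately have "range ((*v) (Y ** transpose Y)) = range ((*v) Y)" by simp
  then show ?thesis using r by (simp add: rank_dim_range)
qed

lemma pos_semidefinite_mul_transpose:
  "pos_semidefinite (Y ** transpose Y)"
  unfolding pos_semidefinite_def
proof (intro conjI allI)
  show "transpose (Y ** transpose Y) = Y ** transpose Y"
    by (simp add: matrix_transpose_mul)
  show "0 \<le> u \<bullet> (Y ** transpose Y *v u)" for u
    by (metis dot_lmul_matrix inner_ge_zero matrix_vector_mul_assoc transpose_matrix_vector)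
qed

subsection \<open>The semidefinite program of the cube\<close>

lemma trace_block_matrix:
  "trace (block_matrix A S B) = 1 + (\<Sum>i\<in>UNIV. A $ i $ i) + (\<Sum>j\<in>UNIV. B $ j $ j)"
  by (simp add: trace_def sum_UNIV_sum_type block_matrix_def UNIV_unit)

lemma bilinear_matrix_form: "bilinear (\<lambda>u w. u \<bullet> ((X :: real^'p^'q) *v w))"
  by (auto simp: bilinear_def intro!: linearI simp: inner_add_left inner_add_right
      matrix_vector_right_distrib matrix_vector_mult_scaleR)

lemma matrix_form_axis: "axis p 1 \<bullet> ((X :: real^'p^'q) *v axis q 1) = X $ p $ q"
  by (simp add: inner_axis' matrix_vector_mult_basis column_def)

lemma matrix_form_commute:
  assumes "transpose X = (X :: real^'p^'p)"
  shows "u \<bullet> (X *v w) = w \<bullet> (X *v u)"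
  by (metis assms dot_lmul_matrix inner_commute transpose_matrix_vector)

text \<open>Facet \<open>j\<close> is the part of the cube on which coordinate \<open>\<kappa> j\<close> equals the sign \<open>s j\<close>.\<close>

locale cube_sdp =
  fixes v :: "'n::finite \<Rightarrow> real^'d"
    and \<kappa> :: "'m::finite \<Rightarrow> 'd"
    and s :: "'m \<Rightarrow> real"
    and Iz :: "('n \<times> 'm) set"
  assumes vertices: "bij_betw v UNIV {x. x extreme_point_of cube}"
    and facets: "bij_betw (\<lambda>j. (\<kappa> j, s j)) UNIV (UNIV \<times> {-1, 1})"
    and Iz: "Iz = {(i, j). v i $ \<kappa> j = s j}"
begin

lemma card_vertices: "CARD('n) = 2 ^ CARD('d)"
  using bij_betw_same_card[OF vertices] by (simp add: card_extreme_points_of_cube)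

lemma card_facets: "CARD('m) = 2 * CARD('d)"
  using bij_betw_same_card[OF facets] by (simp add: card_cartesian_product)

lemma vertex_sign: "v i $ k \<in> {-1, 1}"
  using bij_betwE[OF vertices] extreme_point_of_cube by blast

lemma facet_sign: "s j \<in> {-1, 1}"
  using bij_betwE[OF facets] by blast

lemma sum_vertex: "(\<Sum>i\<in>UNIV. v i $ k) = 0"
  using sum.reindex_bij_betw[OF vertices, of "\<lambda>x. x $ k"] by (simp add: sum_cube_coordinate)

lemma sum_vertex_mult:
  "(\<Sum>i\<in>UNIV. v i $ k * v i $ l) = (if k = l then 2 ^ CARD('d) else 0)"
  using sum.reindex_bij_betw[OF vertices, of "\<lambda>x. x $ k * x $ l"]
  by (simp add: sum_cube_coordinate_mult)

text \<open>Each coordinate carries two opposite facets.\<close>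

lemma sum_facets: "(\<Sum>j\<in>UNIV. g (\<kappa> j)) = 2 * (\<Sum>k\<in>UNIV. g k :: real)"
proof -
  have "(\<Sum>j\<in>UNIV. g (\<kappa> j)) = (\<Sum>(k, t)\<in>UNIV \<times> {-1, 1 :: real}. g k)"
    using sum.reindex_bij_betw[OF facets, of "\<lambda>(k, t). g k"] by simp
  also have "\<dots> = (\<Sum>k\<in>UNIV. \<Sum>t\<in>{-1, 1 :: real}. g k)"
    by (rule sum.cartesian_product[symmetric])
  finally show ?thesis by (simp add: sum_distrib_left)
qed

text \<open>Feasibility fixes the diagonal of \<open>A\<close>, and \<open>S\<close> vanishes on
  \<open>Iz\<close>, so the weighted sum may run over all pairs with weight \<open>L\<close>. The
  objective splits into one term per facet.\<close>

lemma sdp_objective_feasible: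
  assumes "sdp_feasible Iz A S B" and "\<And>i j. (i, j) \<notin> Iz \<Longrightarrow> lam i j = L"
  shows "sdp_objective Iz lam A S B =
    1 + 2 * 2 ^ CARD('d) + (\<Sum>j\<in>UNIV. B $ j $ j - L * (\<Sum>i\<in>UNIV. S $ i $ j))"
proof -
  have zero: "S $ i $ j = 0" if "(i, j) \<in> Iz" for i j
    using assms(1) that by (auto simp: sdp_feasible_def)
  have "(\<Sum>(i, j)\<in>- Iz. lam i j * S $ i $ j) = (\<Sum>(i, j)\<in>- Iz. L * S $ i $ j)"
    by (rule sum.cong) (use assms(2) in auto)
  also have "\<dots> = (\<Sum>(i, j)\<in>UNIV. L * S $ i $ j)"
    by (rule sum.mono_neutral_left) (auto simp: zero)
  also have "\<dots> = (\<Sum>i\<in>UNIV. \<Sum>j\<in>UNIV. L * S $ i $ j)"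
    unfolding UNIV_Times_UNIV[symmetric] by (rule sum.cartesian_product[symmetric])
  also have "\<dots> = (\<Sum>j\<in>UNIV. \<Sum>i\<in>UNIV. L * S $ i $ j)"
    by (rule sum.swap)
  also have "\<dots> = (\<Sum>j\<in>UNIV. L * (\<Sum>i\<in>UNIV. S $ i $ j))"
    by (simp add: sum_distrib_left)
  finally show ?thesis
    using assms(1)
    by (simp add: sdp_objective_def trace_block_matrix sdp_feasible_def card_vertices sum_subtractf)
qed

section \<open>Lower bound for the objective\<close>

lemma sdp_objective_ge:
  assumes feas: "sdp_feasible Iz A S B"
    and lam: "\<And>i j. (i, j) \<notin> Iz \<Longrightarrow> lam i j = 2 * real CARD('d) / 2 ^ CARD('d)"
  shows "1 + 2 * 2 ^ CARD('d) + 2 * real CARD('d) - 2 * (real CARD('d))\<^sup>2 \<le> sdp_objective Iz lam A S B"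
proof -
  define X where "X = block_matrix A S B"
  define \<beta> where "\<beta> = (\<lambda>u w. u \<bullet> (X *v w))"
  define x where "x = (axis (Inl ()) 1 :: real^(unit + 'n + 'm))"
  define a where "a = (\<lambda>i. axis (Inr (Inl i)) 1 :: real^(unit + 'n + 'm))"
  define b where "b = (\<lambda>j. axis (Inr (Inr j)) 1 :: real^(unit + 'n + 'm))"
  define N where "N = (2 :: real) ^ CARD('d)"
  define L where "L = 2 * real CARD('d) / N"
  \<comment> \<open>Since the coordinates sum to zero over the vertices, subtracting
    \<open>x\<close> leaves \<open>C k\<close> unchanged. It lowers the squared norm of each summand
    vector from 2 to 1, which makes Bessel's inequality sharp enough.\<close>
  define C where "C = (\<lambda>k. \<Sum>i\<in>UNIV. v i $ k *\<^sub>R (a i - x))"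
  have psd: "0 \<le> \<beta> u u" for u
    using feas by (simp add: \<beta>_def X_def sdp_feasible_def pos_semidefinite_def)
  have sym: "\<beta> u w = \<beta> w u" for u w
    unfolding \<beta>_def by (rule matrix_form_commute)
      (use feas in \<open>simp add: X_def sdp_feasible_def pos_semidefinite_def\<close>)
  have bil: "bilinear \<beta>"
    unfolding \<beta>_def by (rule bilinear_matrix_form)
  then have lin: "linear (\<lambda>u. \<beta> u w)" for w by (simp add: bilinear_def)
  have xx: "\<beta> x x = 1" and ax: "\<beta> (a i) x = 1" and xb: "\<beta> x (b j) = 1" and aa: "\<beta> (a i) (a i) = 2"
    and ab: "\<beta> (a i) (b j) = S $ i $ j" and bb: "\<beta> (b j) (b j) = B $ j $ j" for i j
    using feas
    by (simp_all add: \<beta>_def x_def a_def b_def X_def matrix_form_axis block_matrix_def sdp_feasible_def)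
  have C: "\<beta> (C k) w = (\<Sum>i\<in>UNIV. v i $ k * \<beta> (a i) w)" for k w
    by (simp add: C_def linear_sum[OF lin] bilinear_lmul[OF bil] bilinear_lsub[OF bil]
        right_diff_distrib sum_subtractf sum_vertex flip: sum_distrib_right)
  have Cx: "\<beta> (C k) x = 0" for k
    by (simp add: C ax sum_vertex)
  have Cb: "s j * \<beta> (C (\<kappa> j)) (b j) = - (\<Sum>i\<in>UNIV. S $ i $ j)" for j
  proof -
    \<comment> \<open>On an incident pair \<open>S\<close> vanishes; otherwise the vertex coordinate
      is the sign opposite to \<open>s j\<close>.\<close>
    have "s j * (v i $ \<kappa> j * S $ i $ j) = - S $ i $ j" for i
    proof (cases "(i, j) \<in> Iz")
      case True
      then show ?thesis using feas by (auto simp: sdp_feasible_def)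
    next
      case False
      then have "s j * v i $ \<kappa> j = - 1" using vertex_sign[of i "\<kappa> j"] facet_sign[of j] by (auto simp: Iz)
      then show ?thesis by (simp flip: mult.assoc)
    qed
    then show ?thesis by (simp add: C ab sum_distrib_left sum_negf)
  qed
  have "(\<Sum>k\<in>UNIV. \<beta> (C k) (C k)) \<le> N * (\<Sum>i\<in>UNIV. \<beta> (a i - x) (a i - x))"
    unfolding C_def by (rule Bessel_inequality_form[OF bil sym psd]) (simp_all add: N_def sum_vertex_mult)
  also have "\<dots> = N\<^sup>2"
    by (simp add: bilinear_lsub[OF bil] bilinear_rsub[OF bil] aa ax sym[of x "a i" for i] xx
        card_vertices N_def power2_eq_square)
  finally have Bessel: "(\<Sum>k\<in>UNIV. \<beta> (C k) (C k)) \<le> N\<^sup>2" .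
  have facet: "1 - (L / 2)\<^sup>2 * \<beta> (C (\<kappa> j)) (C (\<kappa> j)) \<le> B $ j $ j - L * (\<Sum>i\<in>UNIV. S $ i $ j)" for j
  proof -
    \<comment> \<open>The scaling makes \<open>2 * \<beta> c (b j)\<close> equal to the linear term
      of facet \<open>j\<close> in the objective.\<close>
    define c where "c = (L / 2 * s j) *\<^sub>R C (\<kappa> j)"
    have "s j * s j = 1" using facet_sign[of j] by auto
    then have cc: "\<beta> c c = (L / 2)\<^sup>2 * \<beta> (C (\<kappa> j)) (C (\<kappa> j))"
      by (simp add: c_def bilinear_lmul[OF bil] bilinear_rmul[OF bil] power2_eq_square)
    have cb: "2 * \<beta> c (b j) = - L * (\<Sum>i\<in>UNIV. S $ i $ j)"
      using arg_cong[OF Cb[of j], of "(*) L"] by (simp add: c_def bilinear_lmul[OF bil] mult.assoc)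
    have "\<beta> x c = 0" by (subst sym) (simp add: c_def bilinear_lmul[OF bil] Cx)
    from completed_square_form[OF bil sym psd xx xb[of j] this]
    show ?thesis using cb by (simp add: cc bb)
  qed
  \<comment> \<open>The inner factor 2 arises because opposite facets share the same
    \<open>C k\<close>.\<close>
  have "(L / 2)\<^sup>2 * (2 * (\<Sum>k\<in>UNIV. \<beta> (C k) (C k))) \<le> (L / 2)\<^sup>2 * (2 * N\<^sup>2)"
    using Bessel by (intro mult_left_mono) auto
  also have "\<dots> = 2 * (real CARD('d))\<^sup>2"
    by (simp add: L_def N_def power_divide)
  finally have "2 * real CARD('d) - 2 * (real CARD('d))\<^sup>2 \<le>
      2 * real CARD('d) - (L / 2)\<^sup>2 * (2 * (\<Sum>k\<in>UNIV. \<beta> (C k) (C k)))" by simp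
  also have "\<dots> = (\<Sum>j\<in>UNIV. 1 - (L / 2)\<^sup>2 * \<beta> (C (\<kappa> j)) (C (\<kappa> j)))"
    using sum_facets[of "\<lambda>k. \<beta> (C k) (C k)"]
    by (simp add: sum_subtractf card_facets flip: sum_distrib_left)
  also have "\<dots> \<le> (\<Sum>j\<in>UNIV. B $ j $ j - L * (\<Sum>i\<in>UNIV. S $ i $ j))"
    by (intro sum_mono facet)
  finally show ?thesis
    using sdp_objective_feasible[OF feas lam] by (simp add: L_def N_def)
qed

section \<open>The optimal solution from the regular cube\<close>

definition vertex_block :: "real^'n^'n" where
  "vertex_block = (\<chi> i k. 1 + (v i \<bullet> v k) / CARD('d))"

text \<open>The slack matrix of the cube for the facet inequalities
  \<open>s j * x $ \<kappa> j \<le> 1\<close>.\<close>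

definition slack_block :: "real^'m^'n" where
  "slack_block = (\<chi> i j. 1 - s j * v i $ \<kappa> j)"

definition facet_block :: "real^'m^'m" where
  "facet_block = (\<chi> j l. 1 + (if \<kappa> j = \<kappa> l then CARD('d) * s j * s l else 0))"

text \<open>The rows are the homogenized vertices of the cube inscribed in the unit sphere and the
  homogenized vertices of its polar dual, the latter negated.\<close>

definition gram_factor :: "real^(unit + 'd)^(unit + 'n + 'm)" where
  "gram_factor = (\<chi> p q. case q of
     Inl _ \<Rightarrow> 1
   | Inr k \<Rightarrow> (case p of
       Inl _ \<Rightarrow> 0
     | Inr (Inl i) \<Rightarrow> v i $ k / sqrt CARD('d)
     | Inr (Inr j) \<Rightarrow> (if \<kappa> j = k then - sqrt CARD('d) * s j else 0)))"

lemma gram_factor_mult: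
  "gram_factor ** transpose gram_factor = block_matrix vertex_block slack_block facet_block"
proof -
  let ?G = gram_factor
  have entry: "(?G ** transpose ?G) $ p $ q = 1 + (\<Sum>k\<in>UNIV. ?G $ p $ Inr k * ?G $ q $ Inr k)" for p q
    by (simp add: matrix_matrix_mult_def transpose_def sum_UNIV_sum_type UNIV_unit)
      (simp add: gram_factor_def)
  have vv: "(\<Sum>k\<in>UNIV. ?G $ Inr (Inl i) $ Inr k * ?G $ Inr (Inl i') $ Inr k) = (v i \<bullet> v i') / CARD('d)" for i i'
    by (simp add: gram_factor_def inner_vec_def sum_divide_distrib)
  have vf: "(\<Sum>k\<in>UNIV. ?G $ Inr (Inl i) $ Inr k * ?G $ Inr (Inr j) $ Inr k) = - s j * v i $ \<kappa> j" for i j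
    by (simp add: gram_factor_def if_distrib[of "\<lambda>x. _ * x"] cong: if_cong)
  have fv: "(\<Sum>k\<in>UNIV. ?G $ Inr (Inr j) $ Inr k * ?G $ Inr (Inl i) $ Inr k) = - s j * v i $ \<kappa> j" for i j
    by (subst mult.commute) (rule vf)
  have ff: "(\<Sum>k\<in>UNIV. ?G $ Inr (Inr j) $ Inr k * ?G $ Inr (Inr l) $ Inr k) =
      (if \<kappa> j = \<kappa> l then CARD('d) * s j * s l else 0)" for j l
    by (simp add: gram_factor_def if_distrib[of "\<lambda>x. x * _"] cong: if_cong)
  have "(?G ** transpose ?G) $ p $ q = block_matrix vertex_block slack_block facet_block $ p $ q" for p q
  \<comment> \<open>The row of index \<open>Inl ()\<close> vanishes outside the homogenizing column,
    so only the constant 1 remains there.\<close>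
  proof (cases "\<exists>t. p = Inl t \<or> q = Inl t")
    case True
    then show ?thesis
      unfolding entry by (auto simp: gram_factor_def block_matrix_def split: sum.split)
  next
    case False
    then obtain p' q' where "p = Inr p'" "q = Inr q'" by (meson sum.exhaust)
    then show ?thesis
      unfolding entry
      by (cases p'; cases q')
        (simp_all add: vv vf ff fv block_matrix_def vertex_block_def slack_block_def facet_block_def)
  qed
  then show ?thesis by (simp add: vec_eq_iff)
qed

text \<open>The first row reads off the homogenizing coordinate. The row of a facet with positive
  sign then reads off its coordinate up to the factor \<open>- sqrt CARD('d)\<close>.\<close>

lemma inj_gram_factor: "inj ((*v) gram_factor)"
proof -
  have "x = 0" if "gram_factor *v x = 0" for x
  proof -
    have row: "x $ Inl () + (\<Sum>k\<in>UNIV. gram_factor $ p $ Inr k * x $ Inr k) = 0" for p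
      using arg_cong[OF that, of "\<lambda>y. y $ p"]
      by (simp add: matrix_vector_mult_def sum_UNIV_sum_type UNIV_unit gram_factor_def)
    have 0: "x $ Inl () = 0"
      using row[of "Inl ()"] by (simp add: gram_factor_def)
    have "x $ Inr k = 0" for k
    proof -
      have "(k, 1) \<in> range (\<lambda>j. (\<kappa> j, s j))"
        by (simp add: bij_betw_imp_surj_on[OF facets])
      then obtain j where "\<kappa> j = k" "s j = 1" by auto
      then have "(\<Sum>l\<in>UNIV. if k = l then - sqrt CARD('d) * x $ Inr l else 0) = 0"
        using row[of "Inr (Inr j)"] 0
        by (simp add: gram_factor_def if_distrib[of "\<lambda>x. x * _"] cong: if_cong)
      then show ?thesis by simp
    qed
    with 0 have "x $ q = 0" for q by (cases q) auto
    then show ?thesis by (simp add: vec_eq_iff)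
  qed
  then show ?thesis
    by (simp add: linear_injective_0)
qed

lemma vertex_block_diagonal: "vertex_block $ i $ i = 2"
proof -
  have "v i $ k * v i $ k = 1" for k using vertex_sign[of i k] by auto
  then show ?thesis by (simp add: vertex_block_def inner_vec_def)
qed

lemma slack_block_eq: "slack_block $ i $ j = (if (i, j) \<in> Iz then 0 else 2)"
  using vertex_sign[of i "\<kappa> j"] facet_sign[of j] by (auto simp: slack_block_def Iz)

lemma sdp_feasible_cube: "sdp_feasible Iz vertex_block slack_block facet_block"
  unfolding sdp_feasible_def
  by (auto simp: slack_block_eq vertex_block_diagonal pos_semidefinite_mul_transpose simp flip: gram_factor_mult)

lemma rank_cube: "rank (block_matrix vertex_block slack_block facet_block) = CARD('d) + 1"
  by (simp add: rank_mul_transpose_inj inj_gram_factor flip: gram_factor_mult)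

text \<open>Each of the \<open>2 * CARD('d)\<close> facets contributes \<open>1 - CARD('d)\<close>
  to the objective: the diagonal entry is \<open>1 + CARD('d)\<close> and the weighted column sum is
  \<open>2 * CARD('d)\<close>. The total meets the lower bound.\<close>

lemma sdp_optimal_cube:
  assumes "\<And>i j. (i, j) \<notin> Iz \<Longrightarrow> lam i j = 2 * real CARD('d) / 2 ^ CARD('d)"
  shows "sdp_optimal Iz lam vertex_block slack_block facet_block"
proof -
  have S: "(\<Sum>i\<in>UNIV. slack_block $ i $ j) = 2 ^ CARD('d)" for j
    by (simp add: slack_block_def sum_subtractf card_vertices sum_vertex flip: sum_distrib_left)
  have B: "facet_block $ j $ j = 1 + CARD('d)" for j
    using facet_sign[of j] by (auto simp: facet_block_def)
  have "sdp_objective Iz lam vertex_block slack_block facet_block =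
      1 + 2 * 2 ^ CARD('d) + 2 * real CARD('d) - 2 * (real CARD('d))\<^sup>2"
    by (simp add: sdp_objective_feasible[OF sdp_feasible_cube assms] S B card_facets
        power2_eq_square algebra_simps)
  then show ?thesis
    using sdp_objective_ge[OF _ assms] by (simp add: sdp_optimal_def sdp_feasible_cube)
qed

end

section \<open>Transfer to arbitrary labellings of vertices and facets\<close>

theorem theorem4:
  fixes v :: "'n::finite \<Rightarrow> real^'d"
    and F :: "'m::finite \<Rightarrow> (real^'d) set"
    and Iz :: "('n \<times> 'm) set"
    and lam :: "'n \<Rightarrow> 'm \<Rightarrow> real"
  assumes "CARD('d) \<ge> 2"
    and "bij_betw v UNIV {x. x extreme_point_of (cube :: (real^'d) set)}"
    and "bij_betw F UNIV {G. G facet_of (cube :: (real^'d) set)}"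
    and "Iz = {(i, j). v i \<in> F j}"
    and "\<And>i j. (i, j) \<notin> Iz \<Longrightarrow> lam i j = real CARD('d) * 2 powi (1 - int CARD('d))"
  shows "CARD('n) = 2 ^ CARD('d) \<and> CARD('m) = 2 * CARD('d) \<and>
    (\<exists>A S B. sdp_optimal Iz lam A S B \<and>
       rank (block_matrix A S B) = CARD('d) + 1 \<and>
       (\<forall>i j. (i, j) \<notin> Iz \<longrightarrow> S $ i $ j > 0)) \<and>
    (\<forall>A S B. sdp_optimal Iz lam A S B \<and>
       rank (block_matrix A S B) = CARD('d) + 1 \<and>
       (\<forall>i j. (i, j) \<notin> Iz \<longrightarrow> S $ i $ j > 0) \<longrightarrow>
       inscribability_certificate CARD('d) Iz A S B) \<and>
    inscribable (cube :: (real^'d) set)"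
proof -
  define f where "f = (\<lambda>(k, s). {x \<in> cube. x $ k = s} :: (real^'d) set)"
  \<comment> \<open>\<open>g\<close> returns the coordinate and sign of a facet, translating the
    labelling \<open>F\<close> into the form required by \<open>cube_sdp\<close>.\<close>
  define g where "g = the_inv_into (UNIV \<times> {-1, 1}) f"
  have f: "bij_betw f (UNIV \<times> {-1, 1}) {G. G facet_of (cube :: (real^'d) set)}"
    unfolding f_def by (rule bij_betw_facets_of_cube)
  have fg: "f (g (F j)) = F j" for j
    unfolding g_def by (rule f_the_inv_into_f_bij_betw[OF f]) (use bij_betwE[OF assms(3)] in blast)
  have v: "v i \<in> cube" for i
    using bij_betwE[OF assms(2)] by (auto simp: extreme_point_of_def)
  have "bij_betw (g \<circ> F) UNIV (UNIV \<times> {-1, 1})"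
    unfolding g_def by (rule bij_betw_trans[OF assms(3) bij_betw_the_inv_into[OF f]])
  moreover have "v i \<in> F j \<longleftrightarrow> v i $ fst (g (F j)) = snd (g (F j))" for i j
  proof -
    have "v i \<in> f (g (F j)) \<longleftrightarrow> v i $ fst (g (F j)) = snd (g (F j))"
      by (simp add: f_def v split_beta)
    then show ?thesis by (simp add: fg)
  qed
  ultimately interpret cube_sdp v "\<lambda>j. fst (g (F j))" "\<lambda>j. snd (g (F j))" Iz
    using assms(2,4) by unfold_locales (simp_all add: comp_def)
  have lam: "lam i j = 2 * real CARD('d) / 2 ^ CARD('d)" if "(i, j) \<notin> Iz" for i j
    using assms(5)[OF that] by (simp add: power_int_diff)
  have "inscribability_certificate CARD('d) Iz A S B"
    if "sdp_optimal Iz lam A S B" "rank (block_matrix A S B) = CARD('d) + 1"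
      "\<forall>i j. (i, j) \<notin> Iz \<longrightarrow> S $ i $ j > 0" for A S B
  proof -
    have feas: "sdp_feasible Iz A S B" using that(1) by (simp add: sdp_optimal_def)
    then have zero: "S $ i $ j = 0" if "(i, j) \<in> Iz" for i j
      using that by (auto simp: sdp_feasible_def)
    \<comment> \<open>Zeros on \<open>Iz\<close> come from feasibility; positivity elsewhere makes
      the zero pattern exactly \<open>Iz\<close>.\<close>
    have "S $ i $ j = 0 \<longleftrightarrow> (i, j) \<in> Iz" "0 \<le> S $ i $ j" for i j
      using zero[of i j] that(3)[rule_format, of i j] by force+
    then show ?thesis
      using feas that(2) by (auto simp: inscribability_certificate_def sdp_feasible_def)
  qed
  moreover have "\<exists>A S B. sdp_optimal Iz lam A S B \<and> rank (block_matrix A S B) = CARD('d) + 1 \<and>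
      (\<forall>i j. (i, j) \<notin> Iz \<longrightarrow> S $ i $ j > 0)"
    using sdp_optimal_cube[OF lam] rank_cube
    by (intro exI[of _ vertex_block] exI[of _ slack_block] exI[of _ facet_block]) (simp add: slack_block_eq)
  ultimately show ?thesis
    using card_vertices card_facets inscribable_cube by blast
qed

end
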